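(* Let $a,b\in\mathbb{Z}_{\ge1}$ with $a\ne b$. Define words in the letters $a,b$ by $w_1:=ab$ and $w_{n+1}:=w_nw_nw_n\overset{\leftarrow}{w}_n\overset{\leftarrow}{w}_n$ for $n\ge1$, where $\overset{\leftarrow}{w}$ denotes the reversal of the word $w$; let $w_\infty=\lim w_n$ and let $\alpha=[r_0;r_1,r_2,\ldots]=[a;b,a,b,a,b,b,a,b,a,\ldots]$ be the simple continued fraction whose sequence of partial quotients is $w_\infty$. Let $A_n/B_n$ be the convergents of $\alpha$ and let $D_n$ be the denominator of the $n$th convergent of $\alpha^{-1}=[0;r_0,r_1,\ldots]$. Then $$\|q_h\alpha\|\le2(a+1)\left(\frac{32}a\right)^{2/3}\frac1{q_h^{2/3}},\qquad\|q_h\alpha^{-1}\|\le\frac2a\left(\frac{32}a\right)^{2/3}\frac1{q_h^{2/3}}$$ for all $$q_h:=A_hB_{5h+4}+A_{h-1}B_{5h+3}=B_hD_{5h+5}+B_{h-1}D_{5h+4},\qquad h\in\mathbb{Z}_{\ge1}.$$ Further, $$q_h\,\|q_h\alpha\|\,\|q_h\alpha^{-1}\|\le\frac{4(a+1)}a\left(\frac{32}a\right)^{4/3}\frac1{q_h^{1/3}}$$ for all $q_h$, $h\in\mathbb{Z}_{\ge1}$. Therefore $\alpha$ and $\alpha^{-1}$ satisfy the Littlewood conjecture, i.e. $\liminf_{q\to\infty}q\,\|q\alpha\|\,\|q\alpha^{-1}\|=0$.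
   Context: For real $x$, $\|x\|:=\min_{k\in\mathbb{Z}}|x-k|$; $q$ ranges over positive integers. The convergents $A_n/B_n=[r_0;r_1,\ldots,r_n]$ are given by $A_n=r_nA_{n-1}+A_{n-2}$, $B_n=r_nB_{n-1}+B_{n-2}$ $(n\ge0)$ with $A_{-1}=1$, $B_{-1}=0$, $A_{-2}=0$, $B_{-2}=1$; $D_n$ is given by the same recurrence and initial values as $B_n$, applied to the partial quotients $0,r_0,r_1,\ldots$ of $\alpha^{-1}$. Each $w_n$ is a prefix of $w_{n+1}$ and has length $2\cdot5^{n-1}$; $w_\infty$ is the infinite word having all $w_n$ as prefixes.
   Formalization: The formula for q_h and the bounds are proved only for h with h+1=|w_n|=2·5^{n-1}, n≥1, not for all h≥1; for other h the two expressions for q_h differ (e.g. a=1, b=2, h=2: 53346 and 52514). *)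

theory Defs
  imports "HOL-Analysis.Analysis"
begin

definition nint_dist :: "real \<Rightarrow> real" where
  "nint_dist x = (INF k::int. \<bar>x - of_int k\<bar>)"

(* The recurrence A_n = r_n A_{n-1} + A_{n-2} with A_{-1} = 1, A_{-2} = 0 is started at
   A_0 = r_0 and A_1 = r_1 r_0 + 1; likewise, B_{-1} = 0, B_{-2} = 1 give B_0 = 1 and B_1 = r_1. *)
fun conv_num :: "(nat \<Rightarrow> nat) \<Rightarrow> nat \<Rightarrow> nat" where
  "conv_num r 0 = r 0"
| "conv_num r (Suc 0) = r 1 * r 0 + 1"
| "conv_num r (Suc (Suc n)) = r (Suc (Suc n)) * conv_num r (Suc n) + conv_num r n"

fun conv_den :: "(nat \<Rightarrow> nat) \<Rightarrow> nat \<Rightarrow> nat" where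
  "conv_den r 0 = 1"
| "conv_den r (Suc 0) = r 1"
| "conv_den r (Suc (Suc n)) = r (Suc (Suc n)) * conv_den r (Suc n) + conv_den r n"

definition cf_value :: "(nat \<Rightarrow> nat) \<Rightarrow> real" where
  "cf_value r = lim (\<lambda>n. real (conv_num r n) / real (conv_den r n))"

(* Indexed from 1; the value at 0 is a dummy. *)
fun cf_word :: "nat \<Rightarrow> nat \<Rightarrow> nat \<Rightarrow> nat list" where
  "cf_word a b 0 = []"
| "cf_word a b (Suc 0) = [a, b]"
| "cf_word a b (Suc (Suc n)) =
     (let w = cf_word a b (Suc n) in w @ w @ w @ rev w @ rev w)"

lemma length_cf_word: "length (cf_word a b (Suc n)) = 2 * 5 ^ n"
  by (induction n) (simp_all add: Let_def)

(* Position k lies inside the word with index k + 1, whose length 2 * 5 ^ k exceeds k. *)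
definition limit_word :: "nat \<Rightarrow> nat \<Rightarrow> nat \<Rightarrow> nat" where
  "limit_word a b k = cf_word a b (Suc k) ! k"

lemma cf_word_nth_mono:
  assumes "m \<le> n" "k < length (cf_word a b (Suc m))"
  shows "cf_word a b (Suc n) ! k = cf_word a b (Suc m) ! k"
  using assms(1)
proof (induction n rule: dec_induct)
  case (step i)
  have "length (cf_word a b (Suc m)) \<le> length (cf_word a b (Suc i))"
    unfolding length_cf_word using step.hyps(1) by (simp add: power_increasing)
  with assms(2) have "k < length (cf_word a b (Suc i))" by linarith
  then have "cf_word a b (Suc (Suc i)) ! k = cf_word a b (Suc i) ! k"
    by (simp add: Let_def nth_append)
  with step.IH show ?case by simp
qed simp

lemma limit_word_prefix: "map (limit_word a b) [0..<length (cf_word a b n)] = cf_word a b n"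
proof (cases n)
  case (Suc m)
  have "limit_word a b k = cf_word a b (Suc m) ! k" if k: "k < length (cf_word a b (Suc m))" for k
  proof -
    have "k < 2 ^ k" by (rule less_exp)
    also have "(2::nat) ^ k \<le> 5 ^ k" by (rule power_mono) auto
    finally have "k < length (cf_word a b (Suc k))" unfolding length_cf_word by simp
    then show ?thesis
      unfolding limit_word_def using k cf_word_nth_mono[of m k k a b] cf_word_nth_mono[of k m k a b]
      by (cases "m \<le> k") auto
  qed
  then show ?thesis unfolding Suc by (intro nth_equalityI) auto
qed simp

definition littlewood_pair :: "real \<Rightarrow> real \<Rightarrow> bool" where
  "littlewood_pair x y \<longleftrightarrow>
     liminf (\<lambda>q::nat. ereal (real q * nint_dist (real q * x) * nint_dist (real q * y))) = 0"

end

(* Write W for w_n and W' for its reversal. Products of the matrices (x 1; 1 0) encode convergents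
   and reversal of a word is transposition. Hence q_h is both off-diagonal entries of the symmetric
   matrix of the palindrome W W W W' W' W', so q_h is the denominator of two fractions p/q_h and
   s/q_h whose expansions share with those of alpha and 1/alpha the initial segment
   w_{n+1} = W W W W' W', i.e. five sixths of their length. If B is the denominator belonging to W,
   this makes both distances of the order B / B^5, while q_h is of the order B^6. *)
theory Submission
  imports Defs
begin

section \<open>Growth of the numerators and denominators of convergents\<close>

lemma conv_den_ge_1:
  assumes "\<And>n. r (Suc n) \<ge> 1"
  shows "conv_den r n \<ge> 1"
  using assms
proof (induction r n rule: conv_den.induct)
  case (3 r n)
  then have "conv_den r n \<ge> 1" by blast
  then show ?case by simp
qed auto

text \<open>Positivity is asked only from index 1 on, so this also covers
  \<open>case_nat 0 r\<close>, whose denominators are the numerators of \<open>r\<close>;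
  monotonicity of the numerators will come from there.\<close>

lemma conv_den_Suc_ge:
  assumes "\<And>n. r (Suc n) \<ge> 1"
  shows "conv_den r n \<le> conv_den r (Suc n)"
proof (cases n)
  case (Suc m)
  have "1 * conv_den r n \<le> r (Suc n) * conv_den r n" using assms by (intro mult_right_mono) auto
  then show ?thesis using Suc by (simp only: conv_den.simps mult_1 trans_le_add1)
qed (use assms[of 0] in simp)

lemma conv_den_ge_index:
  assumes "\<And>n. r (Suc n) \<ge> 1"
  shows "n \<le> conv_den r n"
  using assms
proof (induction n rule: induct_nat_012)
  case (ge2 n)
  have "1 * conv_den r (Suc n) \<le> r (Suc (Suc n)) * conv_den r (Suc n)"
    using ge2.prems by (intro mult_right_mono) auto
  moreover have "Suc n \<le> conv_den r (Suc n)" "1 \<le> conv_den r n"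
    using ge2 conv_den_ge_1[of r n] by blast+
  ultimately show ?case unfolding conv_den.simps by linarith
qed auto

text \<open>With \<open>conv_num_le\<close> this confines A_n/B_n to [r_0, r_0 + 1]. Trading A_h for
  B_h in this way brings the factors a and a + 1 into the estimates.\<close>

lemma conv_num_ge:
  assumes "\<And>n. r (Suc n) \<ge> 1"
  shows "r 0 * conv_den r n \<le> conv_num r n"
  using assms by (induction r n rule: conv_num.induct) (auto simp: algebra_simps add_mono)

lemma conv_num_le:
  assumes "\<And>n. r (Suc n) \<ge> 1"
  shows "conv_num r n \<le> (r 0 + 1) * conv_den r n"
  using assms
proof (induction r n rule: conv_num.induct)
  case (3 r n)
  have "r (Suc (Suc n)) * conv_num r (Suc n) \<le> r (Suc (Suc n)) * ((r 0 + 1) * conv_den r (Suc n))"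
    using 3 by (intro mult_left_mono) auto
  moreover have "conv_num r n \<le> (r 0 + 1) * conv_den r n" using 3 by blast
  ultimately show ?case by (simp add: algebra_simps)
next
  case (2 r)
  then show ?case using "2"[of 0] by (simp add: algebra_simps)
qed simp

text \<open>Together with \<open>conv_den_case_nat_0\<close> this reduces 1/\<alpha> to \<alpha>: a
  leading partial quotient 0 inverts every convergent and moves the index up by one.\<close>

lemma conv_num_case_nat_0: "conv_num (case_nat 0 r) (Suc n) = conv_den r n"
  by (induction r n rule: conv_den.induct) auto

lemma conv_den_case_nat_0: "conv_den (case_nat 0 r) (Suc n) = conv_num r n"
  by (induction r n rule: conv_num.induct) auto

section \<open>Approximation by fractions sharing an initial segment of the expansion\<close>

lemma conv_det:
  "\<bar>real (conv_num r (Suc n)) * conv_den r n - real (conv_num r n) * conv_den r (Suc n)\<bar> = 1"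
proof (induction n)
  case (Suc n)
  have "real (conv_num r (Suc (Suc n))) * conv_den r (Suc n)
          - real (conv_num r (Suc n)) * conv_den r (Suc (Suc n))
        = - (real (conv_num r (Suc n)) * conv_den r n - real (conv_num r n) * conv_den r (Suc n))"
    by (simp add: algebra_simps)
  then show ?case using Suc by simp
qed simp

text \<open>X and Y are the continuants of r_(m+2), ..., r_(m+1+k) and of r_(m+3), ..., r_(m+1+k).
  The tail beyond index m + 1 enters only through this pair, common to numerator and
  denominator.\<close>

lemma conv_extend:
  assumes pos: "\<And>n. r (Suc n) \<ge> 1"
  shows "\<exists>X Y. 1 \<le> X \<and> Y \<le> X \<and>
    conv_num r (Suc m + k) = conv_num r (Suc m) * X + conv_num r m * Y \<and>
    conv_den r (Suc m + k) = conv_den r (Suc m) * X + conv_den r m * Y"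
proof (induction k rule: induct_nat_012)
  case 0
  show ?case by (rule exI[of _ 1], rule exI[of _ 0]) simp
next
  case 1
  show ?case
    using pos[of "Suc m"] by (intro exI[of _ "r (Suc (Suc m))"] exI[of _ 1]) simp
next
  case (ge2 k)
  then obtain X Y X' Y' where *:
      "1 \<le> X" "Y \<le> X" "1 \<le> X'" "Y' \<le> X'"
      "conv_num r (Suc m + k) = conv_num r (Suc m) * X + conv_num r m * Y"
      "conv_den r (Suc m + k) = conv_den r (Suc m) * X + conv_den r m * Y"
      "conv_num r (Suc (Suc m + k)) = conv_num r (Suc m) * X' + conv_num r m * Y'"
      "conv_den r (Suc (Suc m + k)) = conv_den r (Suc m) * X' + conv_den r m * Y'"
    unfolding add_Suc_right by blast
  let ?x = "r (Suc (Suc (Suc m + k)))"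
  have "?x * Y' + Y \<le> ?x * X' + X" using * by (intro add_mono mult_left_mono) auto
  moreover have "1 \<le> ?x * X' + X" using * by simp
  moreover have "conv_num r (Suc m + Suc (Suc k))
      = conv_num r (Suc m) * (?x * X' + X) + conv_num r m * (?x * Y' + Y)"
    using *(5,7) unfolding add_Suc_right conv_num.simps(3) by (simp only: algebra_simps)
  moreover have "conv_den r (Suc m + Suc (Suc k))
      = conv_den r (Suc m) * (?x * X' + X) + conv_den r m * (?x * Y' + Y)"
    using *(6,8) unfolding add_Suc_right conv_den.simps(3) by (simp only: algebra_simps)
  ultimately show ?case by blast
qed

text \<open>For d > 0 the fraction formed with c and d is [r_0; ..., r_(m+1), c/d]. It and the N-th
  convergent are combinations of the same two consecutive convergents, with coefficients (c, d) and
  (X, Y), so the cross difference is a determinant of absolute value 1 times dX - cY.\<close>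

lemma conv_approx:
  assumes pos: "\<And>n. r (Suc n) \<ge> 1" and "d \<le> c" and "N \<ge> Suc m"
  shows "\<bar>real (conv_den r (Suc m) * c + conv_den r m * d) * (conv_num r N / conv_den r N)
           - real (conv_num r (Suc m) * c + conv_num r m * d)\<bar> \<le> c / conv_den r (Suc m)"
proof -
  let ?A = "\<lambda>n. real (conv_num r n)" and ?B = "\<lambda>n. real (conv_den r n)"
  obtain k where N: "N = Suc m + k" using assms(3) le_iff_add by blast
  obtain X Y where XY: "1 \<le> X" "Y \<le> X"
      and num: "conv_num r N = conv_num r (Suc m) * X + conv_num r m * Y"
      and den: "conv_den r N = conv_den r (Suc m) * X + conv_den r m * Y"
    using conv_extend[where r = r and m = m and k = k, OF pos] N by blast
  have num': "?A N = ?A (Suc m) * X + ?A m * Y" and den': "?B N = ?B (Suc m) * X + ?B m * Y"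
    unfolding num den by simp_all
  have B: "?B n > 0" for n using conv_den_ge_1[where r = r and n = n, OF pos] by simp
  have "real d * X \<le> real c * X" "real c * Y \<le> real c * X"
    using XY assms(2) by (auto intro!: mult_left_mono mult_right_mono)
  \<comment> \<open>Both products lie between 0 and cX.\<close>
  then have dXcY: "\<bar>real d * X - real c * Y\<bar> \<le> real c * X"
    by (smt (verit) mult_nonneg_nonneg of_nat_0_le_iff)
  have "real (conv_den r (Suc m) * c + conv_den r m * d) * (?A N / ?B N)
           - real (conv_num r (Suc m) * c + conv_num r m * d)
      = ((?B (Suc m) * c + ?B m * d) * ?A N - (?A (Suc m) * c + ?A m * d) * ?B N) / ?B N"
    using B[of N] by (simp add: field_simps)
  also have "(?B (Suc m) * c + ?B m * d) * ?A N - (?A (Suc m) * c + ?A m * d) * ?B N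
      = (?A (Suc m) * ?B m - ?A m * ?B (Suc m)) * (real d * X - real c * Y)"
    unfolding num' den' by (simp only: algebra_simps)
  finally have "\<bar>real (conv_den r (Suc m) * c + conv_den r m * d) * (?A N / ?B N)
           - real (conv_num r (Suc m) * c + conv_num r m * d)\<bar>
      = \<bar>real d * X - real c * Y\<bar> / ?B N"
    using B[of N] conv_det[of r m] by (simp add: abs_mult)
  also have "\<dots> \<le> (real c * X) / (?B (Suc m) * X)"
    using dXcY XY B[of "Suc m"] by (intro frac_le) (auto simp: den')
  also have "\<dots> = c / ?B (Suc m)" using XY by simp
  finally show ?thesis .
qed

text \<open>\<open>cf_value\<close> is defined by \<open>lim\<close>, which is informative only for
  convergent sequences. The Cauchy property follows from \<open>conv_approx\<close> with c = 1, d =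
  0 and from B_(m+1) \<ge> m + 1.\<close>

lemma conv_tendsto_cf_value:
  assumes pos: "\<And>n. r (Suc n) \<ge> 1"
  shows "(\<lambda>n. real (conv_num r n) / real (conv_den r n)) \<longlonglongrightarrow> cf_value r"
proof -
  let ?c = "\<lambda>n. real (conv_num r n) / real (conv_den r n)"
  have near: "\<bar>?c N - ?c (Suc m)\<bar> \<le> 1 / real (Suc m)" if "N \<ge> Suc m" for N m
  proof -
    have B: "real (conv_den r (Suc m)) \<ge> real (Suc m)"
      using conv_den_ge_index[where r = r and n = "Suc m", OF pos] by simp
    then have B1: "real (conv_den r (Suc m)) \<ge> 1" by simp
    have "\<bar>?c N - ?c (Suc m)\<bar> * 1 \<le> \<bar>?c N - ?c (Suc m)\<bar> * real (conv_den r (Suc m))"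
      using B1 by (intro mult_left_mono) auto
    also have "\<dots> = \<bar>(?c N - ?c (Suc m)) * real (conv_den r (Suc m))\<bar>" by (simp add: abs_mult)
    also have "\<dots> = \<bar>real (conv_den r (Suc m)) * ?c N - conv_num r (Suc m)\<bar>"
    proof -
      have "(?c N - ?c (Suc m)) * real (conv_den r (Suc m))
          = real (conv_den r (Suc m)) * ?c N - conv_num r (Suc m)"
        using B1 by (simp add: left_diff_distrib)
      then show ?thesis by (rule arg_cong)
    qed
    also have "\<dots> \<le> 1 / real (conv_den r (Suc m))"
      using conv_approx[where r = r and c = 1 and d = 0, OF pos _ that] by simp
    also have "\<dots> \<le> 1 / real (Suc m)" using B by (intro divide_left_mono) auto
    finally show ?thesis by simp
  qed
  have "Cauchy ?c"
  proof (rule CauchyI)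
    fix e :: real assume "e > 0"
    then obtain m where m: "1 / real (Suc m) < e / 2"
      using reals_Archimedean[of "e / 2"] by (auto simp: inverse_eq_divide)
    have "norm (?c i - ?c j) < e" if "i \<ge> Suc m" "j \<ge> Suc m" for i j
      using near[OF that(1)] near[OF that(2)] m unfolding real_norm_def by linarith
    then show "\<exists>M. \<forall>i\<ge>M. \<forall>j\<ge>M. norm (?c i - ?c j) < e" by blast
  qed
  then show ?thesis
    unfolding cf_value_def by (simp add: Cauchy_convergent_iff convergent_LIMSEQ_iff)
qed

lemma nint_dist_le: "nint_dist x \<le> \<bar>x - of_int k\<bar>"
  unfolding nint_dist_def by (rule cINF_lower) (auto intro: bdd_belowI2[where m = 0])

lemma nint_dist_nonneg: "nint_dist x \<ge> 0"
  unfolding nint_dist_def by (rule cINF_greatest) auto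

text \<open>The bound of \<open>conv_approx\<close> does not depend on N, so it survives the limit;
  the nearby integer is the numerator formed with c and d.\<close>

lemma nint_dist_cf_value_le:
  assumes pos: "\<And>n. r (Suc n) \<ge> 1" and "d \<le> c"
  shows "nint_dist (real (conv_den r (Suc m) * c + conv_den r m * d) * cf_value r)
           \<le> c / conv_den r (Suc m)"
proof -
  let ?q = "real (conv_den r (Suc m) * c + conv_den r m * d)"
  let ?p = "conv_num r (Suc m) * c + conv_num r m * d"
  have "(\<lambda>N. \<bar>?q * (conv_num r N / conv_den r N) - real ?p\<bar>) \<longlonglongrightarrow> \<bar>?q * cf_value r - real ?p\<bar>"
    by (intro tendsto_intros conv_tendsto_cf_value pos)
  moreover have "\<forall>\<^sub>F N in sequentially. \<bar>?q * (conv_num r N / conv_den r N) - real ?p\<bar>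
      \<le> c / conv_den r (Suc m)"
    using eventually_ge_at_top[of "Suc m"]
    by eventually_elim (rule conv_approx[where r = r, OF pos assms(2)])
  ultimately have "\<bar>?q * cf_value r - real ?p\<bar> \<le> c / conv_den r (Suc m)"
    by (rule tendsto_upperbound) simp
  then show ?thesis
    using nint_dist_le[of "?q * cf_value r" "int ?p"] by (simp only: of_int_of_nat_eq)
qed

lemma cf_value_case_nat_0:
  assumes pos: "\<And>n. r n \<ge> 1"
  shows "cf_value (case_nat 0 r) = inverse (cf_value r)"
proof -
  let ?c = "\<lambda>n. real (conv_num r n) / real (conv_den r n)"
  have lim: "?c \<longlonglongrightarrow> cf_value r" by (rule conv_tendsto_cf_value) (rule pos)
  have "1 \<le> ?c n" for n
  proof -
    have "1 * conv_den r n \<le> r 0 * conv_den r n" using pos by (intro mult_right_mono) auto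
    then have "conv_den r n \<le> conv_num r n"
      using conv_num_ge[where r = r and n = n, OF pos] by linarith
    then show ?thesis using conv_den_ge_1[of r n] pos by (simp add: field_simps)
  qed
  \<comment> \<open>The limit stays away from 0, so inversion is continuous there.\<close>
  then have "1 \<le> cf_value r" using LIMSEQ_le_const[OF lim] by blast
  then have "(\<lambda>n. inverse (?c n)) \<longlonglongrightarrow> inverse (cf_value r)"
    by (intro tendsto_inverse lim) simp
  then have "(\<lambda>n. real (conv_num (case_nat 0 r) (Suc n)) / real (conv_den (case_nat 0 r) (Suc n)))
      \<longlonglongrightarrow> inverse (cf_value r)"
    by (simp add: conv_num_case_nat_0 conv_den_case_nat_0)
  then have "(\<lambda>n. real (conv_num (case_nat 0 r) n) / real (conv_den (case_nat 0 r) n))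
      \<longlonglongrightarrow> inverse (cf_value r)"
    by (subst (asm) filterlim_sequentially_Suc)
  then show ?thesis unfolding cf_value_def[of "case_nat 0 r"] by (rule limI)
qed

section \<open>Continued fractions as matrix products\<close>

definition cf_mat :: "nat list \<Rightarrow> nat^2^2" where
  "cf_mat xs = foldr (\<lambda>x M. vector [vector [x, 1], vector [1, 0]] ** M) xs (mat 1)"

lemma cf_mat_Nil [simp]: "cf_mat [] = mat 1"
  by (simp add: cf_mat_def)

lemma cf_mat_Cons: "cf_mat (x # xs) = vector [vector [x, 1], vector [1, 0]] ** cf_mat xs"
  by (simp add: cf_mat_def)

lemma cf_mat_single: "cf_mat [x] = vector [vector [x, 1], vector [1, 0]]"
  by (simp add: cf_mat_Cons del: One_nat_def)

lemma cf_mat_append: "cf_mat (xs @ ys) = cf_mat xs ** cf_mat ys"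
  by (induction xs) (simp_all add: cf_mat_Cons matrix_mul_assoc del: One_nat_def)

lemma matrix_mult_2_nth:
  fixes M N :: "nat^2^2"
  shows "(M ** N) $ i $ j = M $ i $ 1 * N $ 1 $ j + M $ i $ 2 * N $ 2 $ j"
  by (simp add: matrix_matrix_mult_def sum_2)

lemma transpose_cf_mat_single: "transpose (cf_mat [x]) = cf_mat [x]"
  by (simp add: cf_mat_single vec_eq_iff forall_2 transpose_def)

text \<open>Each factor (x 1; 1 0) is symmetric, so transposing the product only reverses the order
  of the factors.\<close>

lemma cf_mat_rev: "cf_mat (rev xs) = transpose (cf_mat xs)"
proof (induction xs)
  case (Cons x xs)
  have "cf_mat (rev (x # xs)) = transpose (cf_mat xs) ** transpose (cf_mat [x])"
    by (simp add: cf_mat_append Cons transpose_cf_mat_single)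
  also have "\<dots> = transpose (cf_mat [x] ** cf_mat xs)" by (simp add: matrix_transpose_mul)
  finally show ?case using cf_mat_append[of "[x]" xs] by simp
qed simp

text \<open>Starting with two letters keeps the values at index -1 out of the second column.\<close>

lemma cf_mat_conv:
  "cf_mat (map r [0..<Suc (Suc n)])
     = vector [vector [conv_num r (Suc n), conv_num r n], vector [conv_den r (Suc n), conv_den r n]]"
proof (induction n)
  case 0
  show ?case
    by (simp add: cf_mat_Cons vec_eq_iff forall_2 matrix_mult_2_nth mat_def)
next
  case (Suc n)
  have "cf_mat (map r [0..<Suc (Suc (Suc n))])
      = cf_mat (map r [0..<Suc (Suc n)]) ** cf_mat [r (Suc (Suc n))]"
    unfolding cf_mat_append[symmetric] by simp
  then show ?case
    unfolding Suc by (simp add: cf_mat_single vec_eq_iff forall_2 matrix_mult_2_nth mult.commute)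
qed

lemma le_matrix_mult_nth:
  fixes M N :: "nat^2^2"
  assumes "x \<le> M $ i $ 1" and "y \<le> N $ 1 $ 1"
  shows "x * y \<le> (M ** N) $ i $ 1"
  unfolding matrix_mult_2_nth using mult_mono[OF assms] by (simp add: trans_le_add1)

section \<open>The words w_n and their matrices\<close>

lemma set_cf_word: "set (cf_word a b n) \<subseteq> {a, b}"
  by (induction a b n rule: cf_word.induct) (auto simp: Let_def)

lemma limit_word_range: "limit_word a b k \<in> {a, b}"
proof -
  have "k < 2 * 5 ^ k" by (induction k) auto
  then have "k < length (cf_word a b (Suc k))" by (simp add: length_cf_word)
  then show ?thesis unfolding limit_word_def using set_cf_word nth_mem by blast
qed

lemma limit_word_0: "limit_word a b 0 = a"
  by (simp add: limit_word_def)

text \<open>Here h = k + 1 is the index of the last letter of w_n. Since w_(n+1) has 5(k + 2)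
  letters, its last two indices are 5k + 9 = 5h + 4 and 5k + 8 = 5h + 3, the ones in the definition
  of q_h.\<close>

lemma cf_word_conv:
  fixes a b n k :: nat
  defines "r \<equiv> limit_word a b"
  defines "M \<equiv> cf_mat (cf_word a b n)" and "M' \<equiv> cf_mat (cf_word a b (Suc n))"
  assumes "n \<ge> 1" and len: "Suc (Suc k) = length (cf_word a b n)"
  shows "M = vector [vector [conv_num r (Suc k), conv_num r k],
                     vector [conv_den r (Suc k), conv_den r k]]"
    and "M' = vector [vector [conv_num r (5 * k + 9), conv_num r (5 * k + 8)],
                      vector [conv_den r (5 * k + 9), conv_den r (5 * k + 8)]]"
    and "M' = M ** M ** M ** transpose M ** transpose M"
    and "transpose (M' ** transpose M) = M' ** transpose M"
proof -
  let ?w = "cf_word a b n"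
  obtain m where n: "n = Suc m" using assms(4) by (cases n) auto
  have w': "cf_word a b (Suc n) = ?w @ ?w @ ?w @ rev ?w @ rev ?w"
    unfolding n by (simp add: Let_def)
  have len': "Suc (Suc (5 * k + 8)) = length (cf_word a b (Suc n))"
    unfolding w' using len by simp
  have S: "Suc (5 * k + 8) = 5 * k + 9" by simp
  show "M = vector [vector [conv_num r (Suc k), conv_num r k],
                    vector [conv_den r (Suc k), conv_den r k]]"
    unfolding M_def r_def
    using cf_mat_conv[of "limit_word a b" k] limit_word_prefix[of a b n] len by simp
  show "M' = vector [vector [conv_num r (5 * k + 9), conv_num r (5 * k + 8)],
                      vector [conv_den r (5 * k + 9), conv_den r (5 * k + 8)]]"
    using cf_mat_conv[of r "5 * k + 8"]
    unfolding M'_def r_def len' limit_word_prefix unfolding S .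
  show "M' = M ** M ** M ** transpose M ** transpose M"
    unfolding M'_def M_def w' by (simp add: cf_mat_append cf_mat_rev matrix_mul_assoc)
  \<comment> \<open>Appending one more reversed copy of w_n to w_(n+1) completes a
    palindrome.\<close>
  have "M' ** transpose M = cf_mat (cf_word a b (Suc n) @ rev ?w)"
    unfolding M'_def M_def by (simp add: cf_mat_append cf_mat_rev)
  then show "transpose (M' ** transpose M) = M' ** transpose M"
    by (simp add: cf_mat_rev[symmetric] w')
qed

section \<open>Real estimates and the lower limit\<close>

lemma le_powr_two_thirds:
  fixes x C t q :: real
  assumes "C \<ge> 0" "t \<ge> 0" "q > 0" and le: "x ^ 3 * q ^ 2 \<le> C ^ 3 * t ^ 2"
  shows "x \<le> C * t powr (2 / 3) * (1 / q powr (2 / 3))"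
\<comment> \<open>Comparing cubes turns the exponents 2/3 into squares. The cube is written
  \<open>Suc 2\<close> to fit the form of the rule.\<close>
proof (rule power_le_imp_le_base)
  have cube: "(z powr (2 / 3)) ^ Suc 2 = z ^ 2" if "z \<ge> 0" for z :: real
    using that by (cases "z = 0") (auto simp: powr_power powr_numeral)
  have "x ^ Suc 2 \<le> C ^ 3 * t ^ 2 / q ^ 2" using le assms(3) by (simp add: field_simps)
  also have "\<dots> = C ^ Suc 2 * (t powr (2 / 3)) ^ Suc 2 / (q powr (2 / 3)) ^ Suc 2"
    using cube[of t] cube[of q] assms by (simp only: less_imp_le) simp
  also have "\<dots> = (C * t powr (2 / 3) * (1 / q powr (2 / 3))) ^ Suc 2"
    by (simp only: power_mult_distrib power_divide power_one) simp
  finally show "x ^ Suc 2 \<le> (C * t powr (2 / 3) * (1 / q powr (2 / 3))) ^ Suc 2" .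
qed (use assms in auto)

text \<open>This is the origin of the exponent 2/3. In the application x/y bounds a distance, q is
  at most 2xy and y is at least of the order x^5, so the factors y^2 and x^2 from q^2 leave 4x^5/y,
  which is bounded.\<close>

lemma cube_quotient_le:
  fixes x y q C :: real
  assumes "x \<ge> 0" "y > 0" "0 \<le> q" "q \<le> 2 * x * y" and le: "4 * x ^ 5 \<le> C * y"
  shows "(x / y) ^ 3 * q ^ 2 \<le> C"
proof -
  have "(x / y) ^ 3 * q ^ 2 \<le> (x / y) ^ 3 * (2 * x * y) ^ 2"
    using assms by (intro mult_left_mono power_mono) auto
  also have "\<dots> = 4 * x ^ 5 / y" using assms(2) by (simp add: field_simps power2_eq_square eval_nat_numeral)
  also have "\<dots> \<le> C" using le assms(2) by (simp add: field_simps)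
  finally show ?thesis .
qed

text \<open>A positive lower limit would keep f above some c > 0 eventually, hence also along g. It
  suffices that g tends to infinity; it need not be increasing.\<close>

lemma liminf_eq_0:
  fixes f :: "nat \<Rightarrow> real"
  assumes nonneg: "\<And>n. 0 \<le> f n" and g: "filterlim g at_top sequentially"
    and lim: "(\<lambda>n. f (g n)) \<longlonglongrightarrow> 0"
  shows "liminf (\<lambda>n. ereal (f n)) = 0"
proof (rule antisym)
  show "0 \<le> liminf (\<lambda>n. ereal (f n))"
    by (rule Liminf_bounded) (simp add: nonneg)
  show "liminf (\<lambda>n. ereal (f n)) \<le> 0"
  proof (rule ccontr)
    assume "\<not> ?thesis"
    then obtain c where c: "0 < ereal c" "ereal c < liminf (\<lambda>n. ereal (f n))"
      using ereal_dense2[of 0 "liminf (\<lambda>n. ereal (f n))"] by (auto simp: not_le)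
    then have "\<forall>\<^sub>F n in sequentially. c < f n" using less_LiminfD by fastforce
    then have "\<forall>\<^sub>F n in sequentially. c < f (g n)" using g by (rule eventually_compose_filterlim)
    moreover have "\<forall>\<^sub>F n in sequentially. f (g n) < c"
      using order_tendstoD(2)[OF lim] c(1) by simp
    ultimately have "\<forall>\<^sub>F n in sequentially. False" by eventually_elim simp
    then show False by simp
  qed
qed

text \<open>All entries are nonnegative, so only the summand through the (1,1) entries is kept in
  each product; transposition leaves that entry unchanged. For the matrix of w_n the entries (1,1)
  and (2,1) are A_h and B_h.\<close>

lemma matrix_palindrome_bounds:
  fixes M M' :: "nat^2^2"
  assumes "M' = M ** M ** M ** transpose M ** transpose M"
  shows "M $ 2 $ 1 * M $ 1 $ 1 ^ 4 \<le> M' $ 2 $ 1" and "M $ 1 $ 1 ^ 5 \<le> M' $ 1 $ 1"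
proof -
  have "M $ i $ 1 * M $ 1 $ 1 * M $ 1 $ 1 * M $ 1 $ 1 * M $ 1 $ 1 \<le> M' $ i $ 1" for i
    unfolding assms by (intro le_matrix_mult_nth) (simp_all add: transpose_def)
  from this[of 1] this[of 2] show "M $ 2 $ 1 * M $ 1 $ 1 ^ 4 \<le> M' $ 2 $ 1"
    and "M $ 1 $ 1 ^ 5 \<le> M' $ 1 $ 1"
    by (simp_all add: eval_nat_numeral mult_ac)
qed

text \<open>The condition on h makes r_0, ..., r_(5h+4), r_h, ..., r_0 a palindrome, which fails for
  instance at h = 2. These h are unbounded, which is enough for the lower limit.\<close>

theorem theorem26:
  fixes a b :: nat and r A B D q :: "nat \<Rightarrow> nat" and \<alpha> :: real
  assumes "a \<ge> 1" and "b \<ge> 1" and "a \<noteq> b"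
    and "r = limit_word a b"
    and "\<alpha> = cf_value r"
    and "A = conv_num r" and "B = conv_den r"
    and "D = conv_den (case_nat 0 r)"
    and "q = (\<lambda>h. A h * B (5 * h + 4) + A (h - 1) * B (5 * h + 3))"
  shows "cf_value (case_nat 0 r) = inverse \<alpha> \<and>
    (\<forall>h\<ge>1. (\<exists>n\<ge>1. h + 1 = length (cf_word a b n)) \<longrightarrow>
       q h = B h * D (5 * h + 5) + B (h - 1) * D (5 * h + 4) \<and>
       nint_dist (real (q h) * \<alpha>)
         \<le> 2 * (real a + 1) * (32 / real a) powr (2 / 3) * (1 / real (q h) powr (2 / 3)) \<and>
       nint_dist (real (q h) * inverse \<alpha>)
         \<le> 2 / real a * (32 / real a) powr (2 / 3) * (1 / real (q h) powr (2 / 3)) \<and>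
       real (q h) * nint_dist (real (q h) * \<alpha>) * nint_dist (real (q h) * inverse \<alpha>)
         \<le> 4 * (real a + 1) / real a * (32 / real a) powr (4 / 3) * (1 / real (q h) powr (1 / 3))) \<and>
    littlewood_pair \<alpha> (inverse \<alpha>)"
proof -
  have pos: "r n \<ge> 1" for n using limit_word_range[of a b n] assms(1,2,4) by auto
  have r0: "r 0 = a" by (simp add: assms(4) limit_word_0)
  have B1: "B n \<ge> 1" for n unfolding assms(7) by (rule conv_den_ge_1) (rule pos)
  have A_ge: "a * B n \<le> A n" for n
    unfolding assms(6,7) r0[symmetric] by (rule conv_num_ge) (rule pos)
  have A_le: "A n \<le> (a + 1) * B n" for n
    unfolding assms(6,7) r0[symmetric] by (rule conv_num_le) (rule pos)
  have A1: "A n \<ge> 1" for n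
    using A_ge[of n] B1[of n] assms(1) by (metis dual_order.trans mult_le_mono mult_1)
  have B_mono: "B n \<le> B (Suc n)" for n
    unfolding assms(7) by (rule conv_den_Suc_ge) (rule pos)
  \<comment> \<open>The numerators are denominators of the expansion with 0 in front.\<close>
  have A_mono: "A n \<le> A (Suc n)" for n
    unfolding assms(6) conv_den_case_nat_0[symmetric] by (rule conv_den_Suc_ge) (use pos in simp)
  have D_Suc: "D (Suc n) = A n" for n unfolding assms(6,8) by (rule conv_den_case_nat_0)
  have inv: "cf_value (case_nat 0 r) = inverse \<alpha>"
    unfolding assms(5) by (rule cf_value_case_nat_0) (rule pos)
  have a: "real a \<ge> 1" using assms(1) by simp

  \<comment> \<open>The added claim \<open>q h \<ge> h\<close> gives positivity here and divergence
    of q_h in the final limit.\<close>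
  have main: "q h = B h * D (5 * h + 5) + B (h - 1) * D (5 * h + 4) \<and> q h \<ge> h \<and>
       nint_dist (real (q h) * \<alpha>)
         \<le> 2 * (real a + 1) * (32 / real a) powr (2 / 3) * (1 / real (q h) powr (2 / 3)) \<and>
       nint_dist (real (q h) * inverse \<alpha>)
         \<le> 2 / real a * (32 / real a) powr (2 / 3) * (1 / real (q h) powr (2 / 3))"
    if h: "h \<ge> 1" and n: "n \<ge> 1" "h + 1 = length (cf_word a b n)" for h n
  proof -
    obtain k where k: "h = Suc k" using h by (cases h) auto
    have len: "Suc (Suc k) = length (cf_word a b n)" using n k by simp
    define M where "M = cf_mat (cf_word a b n)"
    define M' where "M' = cf_mat (cf_word a b (Suc n))"
    note * = cf_word_conv[OF n(1) len, folded assms(4) M_def M'_def, folded assms(6,7)]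
    let ?A = "A (Suc k)" and ?B = "B (Suc k)" and ?A5 = "A (5 * k + 9)" and ?B5 = "B (5 * k + 9)"
    \<comment> \<open>The entry (2,1) is the defining expression of q_h, and (1,2) is the one that
      becomes the formula with D.\<close>
    have "(M' ** transpose M) $ 2 $ 1 = (M' ** transpose M) $ 1 $ 2"
      using arg_cong[OF *(4), of "\<lambda>N. N $ 1 $ 2"] by (simp add: transpose_def)
    then have sym: "?B5 * ?A + B (5 * k + 8) * A k = ?A5 * ?B + A (5 * k + 8) * B k"
      unfolding matrix_mult_2_nth by (simp add: transpose_def *(1,2))
    have q1: "q h = ?B5 * ?A + B (5 * k + 8) * A k"
      unfolding assms(9) k by (simp add: algebra_simps)
    have q2: "q h = ?A5 * ?B + A (5 * k + 8) * B k" using q1 sym by simp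
    have qD: "q h = B h * D (5 * h + 5) + B (h - 1) * D (5 * h + 4)"
    proof -
      have "5 * h + 5 = Suc (5 * k + 9)" "5 * h + 4 = Suc (5 * k + 8)" using k by auto
      then show ?thesis unfolding q2 by (simp only: D_Suc) (simp add: k mult.commute)
    qed
    have S: "Suc (5 * k + 8) = 5 * k + 9" by simp
    \<comment> \<open>Take c = A_h and d = A_(h-1), with B_(5h+4) as the larger denominator.\<close>
    have n1: "nint_dist (real (q h) * \<alpha>) \<le> real ?A / real ?B5"
      using nint_dist_cf_value_le[where r = r and m = "5 * k + 8", OF pos A_mono[of k]]
      unfolding S q1 assms(5) by (simp add: assms(7))
    have n2: "nint_dist (real (q h) * inverse \<alpha>) \<le> real ?B / real ?A5"
    proof -
      \<comment> \<open>Here c = B_h and d = B_(h-1). The leading 0 shifts the index by one, and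
        D_(5h+5) = A_(5h+4).\<close>
      have "nint_dist (real (D (Suc (Suc (5 * k + 8))) * ?B + D (Suc (5 * k + 8)) * B k)
          * cf_value (case_nat 0 r)) \<le> ?B / D (Suc (Suc (5 * k + 8)))"
        unfolding assms(8) by (rule nint_dist_cf_value_le) (use pos B_mono in simp_all)
      then show ?thesis unfolding q2 inv D_Suc unfolding S .
    qed
    have "h \<le> 5 * k + 9" using k by simp
    also have "\<dots> \<le> ?B5" unfolding assms(7) by (rule conv_den_ge_index) (rule pos)
    also have "\<dots> \<le> ?B5 * ?A" using A1[of "Suc k"] by simp
    also have "\<dots> \<le> q h" unfolding q1 by simp
    finally have qh: "q h \<ge> h" .
    then have q0: "real (q h) > 0" using h by simp
    \<comment> \<open>By monotonicity the second summand of q_h is at most the first, whence the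
      factor 2.\<close>
    have "B (5 * k + 8) * A k \<le> ?B5 * ?A"
      using A_mono[of k] B_mono[of "5 * k + 8"] unfolding S by (intro mult_mono) auto
    then have "q h \<le> 2 * ?A * ?B5" unfolding q1 by (simp add: mult_ac)
    then have q1_le: "real (q h) \<le> 2 * real ?A * real ?B5"
      by (metis of_nat_le_iff of_nat_mult of_nat_numeral)
    have "A (5 * k + 8) * B k \<le> ?A5 * ?B"
      using B_mono[of k] A_mono[of "5 * k + 8"] unfolding S by (intro mult_mono) auto
    then have "q h \<le> 2 * ?B * ?A5" unfolding q2 by (simp add: mult_ac)
    then have q2_le: "real (q h) \<le> 2 * real ?B * real ?A5"
      by (metis of_nat_le_iff of_nat_mult of_nat_numeral)
    have B5: "real ?B * real ?A ^ 4 \<le> real ?B5" and A5: "real ?A ^ 5 \<le> real ?A5"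
      using matrix_palindrome_bounds[OF *(3)]
      by (simp_all add: *(1,2) flip: of_nat_mult of_nat_power)
    have A_pos: "real (A i) > 0" and B_pos: "real (B i) > 0" for i
      using A1[of i] B1[of i] by auto
    have Al: "real ?A \<le> (real a + 1) * real ?B"
      using A_le[of "Suc k"] by (metis of_nat_1 of_nat_add of_nat_le_iff of_nat_mult)
    have Ag: "real a * real ?B \<le> real ?A"
      using A_ge[of "Suc k"] by (metis of_nat_le_iff of_nat_mult)
    have "4 * real ?A ^ 5 = real ?A * (4 * real ?A ^ 4)" by (simp add: eval_nat_numeral)
    also have "\<dots> \<le> ((real a + 1) * real ?B) * (4 * real ?A ^ 4)"
      using Al by (rule mult_right_mono) simp
    also have "\<dots> = (4 * (real a + 1)) * (real ?B * real ?A ^ 4)" by (simp only: mult_ac)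
    also have "\<dots> \<le> (4 * (real a + 1)) * real ?B5" using B5 by (intro mult_left_mono) auto
    finally have "4 * real ?A ^ 5 \<le> (4 * (real a + 1)) * real ?B5" .
    from cube_quotient_le[OF _ B_pos _ q1_le this]
    have "(real ?A / real ?B5) ^ 3 * real (q h) ^ 2 \<le> 4 * (real a + 1)" by simp
    \<comment> \<open>There is ample room: 2^3 * 32^2 = 8192 stands against 4, and a^2 \<le> (a +
      1)^2.\<close>
    also have "\<dots> \<le> (2 * (real a + 1)) ^ 3 * (32 / real a) ^ 2"
    proof -
      have "real a ^ 2 \<le> (real a + 1) ^ 2" by (rule power_mono) auto
      then have "(4 * (real a + 1)) * real a ^ 2 \<le> (8192 * (real a + 1)) * (real a + 1) ^ 2"
        by (intro mult_mono) auto
      then show ?thesis using a by (simp add: field_simps eval_nat_numeral)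
    qed
    finally have "real ?A / real ?B5
        \<le> 2 * (real a + 1) * (32 / real a) powr (2 / 3) * (1 / real (q h) powr (2 / 3))"
      using q0 by (intro le_powr_two_thirds) auto
    note e1 = order_trans[OF n1 this]
    \<comment> \<open>Replacing B_h by A_h/a produces a^5 in the denominator, exactly the power in
      (2/a)^3 (32/a)^2.\<close>
    have "(4 / real a ^ 5) * (real a * real ?B) ^ 5 \<le> (4 / real a ^ 5) * real ?A ^ 5"
      using Ag by (intro mult_left_mono power_mono) auto
    also have "\<dots> \<le> (4 / real a ^ 5) * real ?A5" using A5 by (intro mult_left_mono) auto
    finally have "4 * real ?B ^ 5 \<le> (4 / real a ^ 5) * real ?A5"
      using a by (simp add: power_mult_distrib)
    from cube_quotient_le[OF _ A_pos _ q2_le this]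
    have "(real ?B / real ?A5) ^ 3 * real (q h) ^ 2 \<le> 4 / real a ^ 5" by simp
    also have "\<dots> \<le> (2 / real a) ^ 3 * (32 / real a) ^ 2"
      using a by (simp add: power_divide flip: power_add) (simp add: divide_right_mono)
    finally have "real ?B / real ?A5
        \<le> 2 / real a * (32 / real a) powr (2 / 3) * (1 / real (q h) powr (2 / 3))"
      using q0 by (intro le_powr_two_thirds) auto
    note e2 = order_trans[OF n2 this]
    from qD qh e1 e2 show ?thesis by blast
  qed

  let ?K = "4 * (real a + 1) / real a * (32 / real a) powr (4 / 3)"
  have prod: "real (q h) * nint_dist (real (q h) * \<alpha>) * nint_dist (real (q h) * inverse \<alpha>)
      \<le> ?K * (1 / real (q h) powr (1 / 3))"
    if h: "h \<ge> 1" and n: "n \<ge> 1" "h + 1 = length (cf_word a b n)" for h n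
  proof -
    note m = main[OF h n]
    let ?t = "(32 / real a) powr (2 / 3)" and ?s = "1 / real (q h) powr (2 / 3)"
    have "q h \<ge> h" using m by blast
    then have q0: "real (q h) > 0" using h by simp
    have "real (q h) * nint_dist (real (q h) * \<alpha>) * nint_dist (real (q h) * inverse \<alpha>)
        \<le> real (q h) * (2 * (real a + 1) * ?t * ?s) * (2 / real a * ?t * ?s)"
      using m by (intro mult_mono) (auto simp: nint_dist_nonneg)
    also have "\<dots> = 2 * (real a + 1) * (2 / real a) * (?t * ?t) * (real (q h) * (?s * ?s))"
      by (simp only: mult_ac)
    also have "2 * (real a + 1) * (2 / real a) = 4 * (real a + 1) / real a"
      using a by (simp add: field_simps)
    also have "?t * ?t = (32 / real a) powr (4 / 3)" unfolding powr_add[symmetric] by simp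
    also have "real (q h) * (?s * ?s) = 1 / real (q h) powr (1 / 3)"
    proof -
      have "real (q h) = real (q h) powr 1" using q0 by simp
      \<comment> \<open>This splitting lets the two factors q_h^(-2/3) cancel and leaves
        q_h^(-1/3).\<close>
      also have "(1::real) = 2 / 3 + 2 / 3 - 1 / 3" by simp
      also have "real (q h) powr (2 / 3 + 2 / 3 - 1 / 3)
          = real (q h) powr (2 / 3) * real (q h) powr (2 / 3) / real (q h) powr (1 / 3)"
        unfolding powr_diff powr_add ..
      finally have "real (q h) * (?s * ?s)
          = real (q h) powr (2 / 3) * real (q h) powr (2 / 3) / real (q h) powr (1 / 3) * (?s * ?s)"
        by (rule arg_cong)
      then show ?thesis using q0 by simp
    qed
    finally show ?thesis .
  qed

  have "littlewood_pair \<alpha> (inverse \<alpha>)"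
    unfolding littlewood_pair_def
  proof (rule liminf_eq_0)
    \<comment> \<open>The index of the last letter of w_(n+1).\<close>
    let ?h = "\<lambda>n. 2 * 5 ^ n - 1 :: nat"
    let ?f = "\<lambda>q. real q * nint_dist (real q * \<alpha>) * nint_dist (real q * inverse \<alpha>)"
    have h: "?h n \<ge> 1" "?h n + 1 = length (cf_word a b (Suc n))" for n
      using one_le_power[of "5::nat" n] unfolding length_cf_word by linarith+
    have Suc_ge_1: "1 \<le> Suc n" for n by simp
    have n_le: "n \<le> q (?h n)" for n
    proof -
      have "n < 2 * 5 ^ n" by (induction n) auto
      then have "n \<le> ?h n" by simp
      also have "\<dots> \<le> q (?h n)" using main[OF h(1) Suc_ge_1 h(2)] by blast
      finally show ?thesis .
    qed
    show "0 \<le> ?f n" for n by (simp add: nint_dist_nonneg)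
    show lim: "filterlim (\<lambda>n. q (?h n)) at_top sequentially"
      by (rule filterlim_at_top_mono[OF filterlim_ident]) (intro always_eventually allI n_le)
    have "filterlim (\<lambda>n. real (q (?h n))) at_top sequentially"
      by (rule filterlim_compose[OF filterlim_real_sequentially lim])
    then have "(\<lambda>n. real (q (?h n)) powr - (1 / 3)) \<longlonglongrightarrow> 0"
      by (intro tendsto_neg_powr) auto
    then have K: "(\<lambda>n. ?K * (1 / real (q (?h n)) powr (1 / 3))) \<longlonglongrightarrow> 0"
      unfolding powr_minus_divide by (rule tendsto_mult_right_zero)
    show "(\<lambda>n. ?f (q (?h n))) \<longlonglongrightarrow> 0"
    proof (rule tendsto_sandwich[OF _ _ tendsto_const K])
      show "\<forall>\<^sub>F n in sequentially. 0 \<le> ?f (q (?h n))" by (simp add: nint_dist_nonneg)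
      show "\<forall>\<^sub>F n in sequentially. ?f (q (?h n)) \<le> ?K * (1 / real (q (?h n)) powr (1 / 3))"
        using prod[OF h(1) Suc_ge_1 h(2)] by (intro always_eventually allI)
    qed
  qed
  with inv main prod show ?thesis by blast
qed

end
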